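(* For a Cartesian left additive category, there is a bijective correspondence between: (i) differential combinators; (ii) systems of linearizing combinators. Therefore, a Cartesian differential category is precisely a Cartesian left additive category equipped with a system of linearizing combinators.
   Context: Composition is in diagrammatic order: $fg$ means first $f$, then $g$; identities are written $1$. A left additive category is a category whose hom-sets are commutative monoids $(+,0)$ with $f(g+h)=fg+fh$ and $f0=0$. A map $f$ is additive if $0f=0$ and $(g+h)f=gf+hf$ for all $g,h$. A Cartesian left additive category is a left additive category with (chosen) finite products whose projections $\pi_0,\pi_1$ are additive; $\langle -,-\rangle$ is pairing and $f\times g=\langle \pi_0 f,\pi_1 g\rangle$. Put $\oplus_A:=\pi_0+\pi_1:A\times A\to A$; $\ell_{A,B,C,D}:=\langle 1,0\rangle\times\langle 0,1\rangle: A\times D\to (A\times B)\times(C\times D)$; $c_{A,B,C,D}:=\langle \pi_0\times\pi_0,\pi_1\times\pi_1\rangle:(A\times B)\times(C\times D)\to(A\times C)\times(B\times D)$ (subscripts omitted). A Cartesian differential category is a Cartesian left additive category $\mathbb{X}$ equipped with a differential combinator $\mathsf{D}$, i.e. a family of operators $\mathsf{D}:\mathbb{X}(A,B)\to\mathbb{X}(A\times A,B)$ such that: [CD.1] $\mathsf{D}[f+g]=\mathsf{D}[f]+\mathsf{D}[g]$, $\mathsf{D}[0]=0$; [CD.2] $(1\times\oplus_A)\mathsf{D}[f]=(1\times\pi_0)\mathsf{D}[f]+(1\times\pi_1)\mathsf{D}[f]$, $\langle 1,0\rangle\mathsf{D}[f]=0$; [CD.3] $\mathsf{D}[1]=\pi_1$,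 $\mathsf{D}[\pi_0]=\pi_1\pi_0$, $\mathsf{D}[\pi_1]=\pi_1\pi_1$; [CD.4] $\mathsf{D}[\langle f,g\rangle]=\langle\mathsf{D}[f],\mathsf{D}[g]\rangle$; [CD.5] $\mathsf{D}[fg]=\langle\pi_0 f,\mathsf{D}[f]\rangle\mathsf{D}[g]$; [CD.6] $\ell\,\mathsf{D}[\mathsf{D}[f]]=\mathsf{D}[f]$; [CD.7] $c\,\mathsf{D}[\mathsf{D}[f]]=\mathsf{D}[\mathsf{D}[f]]$. A system of linearizing combinators on a Cartesian left additive category $\mathbb{X}$ is a family, indexed by objects $C$, of operators $\mathsf{L}^C:\mathbb{X}(C\times A,B)\to\mathbb{X}(C\times A,B)$ such that: [L.1] $\mathsf{L}^{C}[f+g]=\mathsf{L}^{C}[f]+\mathsf{L}^{C}[g]$, $\mathsf{L}^{C}[0]=0$; [L.2] $(1\times\oplus_A)\mathsf{L}^{C}[f]=(1\times\pi_0)\mathsf{L}^{C}[f]+(1\times\pi_1)\mathsf{L}^{C}[f]$, $\langle\pi_0,0\rangle\mathsf{L}^{C}[f]=0$; [L.3] $\mathsf{L}^{C}[\pi_1]=\pi_1$, $\mathsf{L}^{C}[\pi_1\pi_0]=\pi_1\pi_0$, $\mathsf{L}^{C}[\pi_1\pi_1]=\pi_1\pi_1$; [L.4] $\mathsf{L}^{C}[\langle f,g\rangle]=\langle\mathsf{L}^{C}[f],\mathsf{L}^{C}[g]\rangle$; [L.5] for $f:C\times A\to B$, $g:C\times B\to D$, $\mathsf{L}^{C}[\langle\pi_0,f\rangle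 g]=\langle\pi_0,\mathsf{L}^{C}[f]\rangle\,\mathsf{L}^{C}[\langle\pi_0,\pi_1+\langle\pi_0,0\rangle f\rangle g]$; [L.6] $\mathsf{L}^{C}[\mathsf{L}^{C}[f]]=\mathsf{L}^{C}[f]$; [L.7] with the isomorphisms $\alpha=\langle 1\times\pi_0,\pi_1\pi_1\rangle:C\times(A\times B)\to(C\times A)\times B$ and $\beta=\langle 1\times\pi_1,\pi_1\pi_0\rangle:C\times(A\times B)\to(C\times B)\times A$, and for $f:C\times(A\times B)\to D$, $\mathsf{L}^C_0[f]:=\beta\,\mathsf{L}^{C\times B}[\beta^{-1}f]$, $\mathsf{L}^C_1[f]:=\alpha\,\mathsf{L}^{C\times A}[\alpha^{-1}f]$, one has $\mathsf{L}^C_1[\mathsf{L}^C_0[f]]=\mathsf{L}^C_0[\mathsf{L}^C_1[f]]$; [L.8] for every $h:C'\to C$ and $f:C\times A\to B$, $(h\times 1)\mathsf{L}^{C}[f]=\mathsf{L}^{C'}[(h\times 1)f]$. *)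

theory Defs
  imports "HOL-Algebra.Group"
begin

text \<open>
  Objects and arrows are carrier sets in two types. Every arrow has a unique domain and codomain,
  so arrow operations need no object indices. The values of the operations outside the
  carriers, and of \<open>Comp\<close>, \<open>Add\<close>, \<open>Pair\<close> on arrows of the wrong type, are unspecified.
\<close>

record ('o, 'm) cla_data =
  Obj   :: "'o set"
  Arr   :: "'m set"
  Dom   :: "'m \<Rightarrow> 'o"
  Cod   :: "'m \<Rightarrow> 'o"
  Idn   :: "'o \<Rightarrow> 'm"  ("\<^bold>1\<index>")
  Comp  :: "'m \<Rightarrow> 'm \<Rightarrow> 'm"  (infixl "\<cdot>\<index>" 70)  \<comment> \<open>diagrammatic order\<close>
  Zero  :: "'o \<Rightarrow> 'o \<Rightarrow> 'm"  ("\<^bold>0\<index>")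
  Add   :: "'m \<Rightarrow> 'm \<Rightarrow> 'm"  (infixl "\<^bold>+\<index>" 65)
  Term  :: 'o
  Prod  :: "'o \<Rightarrow> 'o \<Rightarrow> 'o"  (infixr "\<^bold>\<times>\<index>" 80)
  Proj0 :: "'o \<Rightarrow> 'o \<Rightarrow> 'm"  ("\<pi>\<^sub>0\<index>")
  Proj1 :: "'o \<Rightarrow> 'o \<Rightarrow> 'm"  ("\<pi>\<^sub>1\<index>")
  Pair  :: "'m \<Rightarrow> 'm \<Rightarrow> 'm"  ("\<langle>_,/ _\<rangle>\<index>")

definition Hom :: "('o, 'm) cla_data \<Rightarrow> 'o \<Rightarrow> 'o \<Rightarrow> 'm set" ("Hom\<index>") where
  "Hom\<^bsub>X\<^esub> A B = {f \<in> Arr X. Dom X f = A \<and> Cod X f = B}"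

definition Hom_monoid :: "('o, 'm) cla_data \<Rightarrow> 'o \<Rightarrow> 'o \<Rightarrow> 'm monoid" where
  "Hom_monoid X A B = \<lparr>carrier = Hom\<^bsub>X\<^esub> A B, mult = Add X, one = \<^bold>0\<^bsub>X\<^esub> A B\<rparr>"

definition additive_map :: "('o, 'm) cla_data \<Rightarrow> 'm \<Rightarrow> bool" where
  "additive_map X f \<longleftrightarrow> f \<in> Arr X \<and>
     (\<forall>A \<in> Obj X. \<^bold>0\<^bsub>X\<^esub> A (Dom X f) \<cdot>\<^bsub>X\<^esub> f = \<^bold>0\<^bsub>X\<^esub> A (Cod X f) \<and>
        (\<forall>g \<in> Hom\<^bsub>X\<^esub> A (Dom X f). \<forall>h \<in> Hom\<^bsub>X\<^esub> A (Dom X f).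
           (g \<^bold>+\<^bsub>X\<^esub> h) \<cdot>\<^bsub>X\<^esub> f = g \<cdot>\<^bsub>X\<^esub> f \<^bold>+\<^bsub>X\<^esub> h \<cdot>\<^bsub>X\<^esub> f))"

locale category =
  fixes X :: "('o, 'm) cla_data" (structure)
  assumes Dom_Obj: "f \<in> Arr X \<Longrightarrow> Dom X f \<in> Obj X"
    and Cod_Obj: "f \<in> Arr X \<Longrightarrow> Cod X f \<in> Obj X"
    and Idn_Hom: "A \<in> Obj X \<Longrightarrow> \<^bold>1 A \<in> Hom A A"
    and Comp_Hom: "\<lbrakk>f \<in> Hom A B; g \<in> Hom B C\<rbrakk> \<Longrightarrow> f \<cdot> g \<in> Hom A C"
    and Comp_Idn_left: "f \<in> Hom A B \<Longrightarrow> \<^bold>1 A \<cdot> f = f"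
    and Comp_Idn_right: "f \<in> Hom A B \<Longrightarrow> f \<cdot> \<^bold>1 B = f"
    and Comp_assoc: "\<lbrakk>f \<in> Hom A B; g \<in> Hom B C; h \<in> Hom C D\<rbrakk> \<Longrightarrow> (f \<cdot> g) \<cdot> h = f \<cdot> (g \<cdot> h)"

locale left_additive_category = category +
  assumes Hom_comm_monoid: "\<lbrakk>A \<in> Obj X; B \<in> Obj X\<rbrakk> \<Longrightarrow> comm_monoid (Hom_monoid X A B)"
    and Comp_Add: "\<lbrakk>f \<in> Hom A B; g \<in> Hom B C; h \<in> Hom B C\<rbrakk>
          \<Longrightarrow> f \<cdot> (g \<^bold>+ h) = f \<cdot> g \<^bold>+ f \<cdot> h"
    and Comp_Zero: "\<lbrakk>f \<in> Hom A B; C \<in> Obj X\<rbrakk> \<Longrightarrow> f \<cdot> \<^bold>0 B C = \<^bold>0 A C"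

locale cartesian_category = category +
  assumes Term_Obj: "Term X \<in> Obj X"
    and Term_universal: "A \<in> Obj X \<Longrightarrow> \<exists>!f. f \<in> Hom A (Term X)"
    and Prod_Obj: "\<lbrakk>A \<in> Obj X; B \<in> Obj X\<rbrakk> \<Longrightarrow> A \<^bold>\<times> B \<in> Obj X"
    and Proj0_Hom: "\<lbrakk>A \<in> Obj X; B \<in> Obj X\<rbrakk> \<Longrightarrow> \<pi>\<^sub>0 A B \<in> Hom (A \<^bold>\<times> B) A"
    and Proj1_Hom: "\<lbrakk>A \<in> Obj X; B \<in> Obj X\<rbrakk> \<Longrightarrow> \<pi>\<^sub>1 A B \<in> Hom (A \<^bold>\<times> B) B"
    and Pair_Hom: "\<lbrakk>f \<in> Hom C A; g \<in> Hom C B\<rbrakk> \<Longrightarrow> \<langle>f, g\<rangle> \<in> Hom C (A \<^bold>\<times> B)"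
    and Pair_Proj0: "\<lbrakk>f \<in> Hom C A; g \<in> Hom C B\<rbrakk> \<Longrightarrow> \<langle>f, g\<rangle> \<cdot> \<pi>\<^sub>0 A B = f"
    and Pair_Proj1: "\<lbrakk>f \<in> Hom C A; g \<in> Hom C B\<rbrakk> \<Longrightarrow> \<langle>f, g\<rangle> \<cdot> \<pi>\<^sub>1 A B = g"
    and Pair_unique: "\<lbrakk>A \<in> Obj X; B \<in> Obj X; h \<in> Hom C (A \<^bold>\<times> B)\<rbrakk>
          \<Longrightarrow> h = \<langle>h \<cdot> \<pi>\<^sub>0 A B, h \<cdot> \<pi>\<^sub>1 A B\<rangle>"

locale cartesian_left_additive_category = left_additive_category + cartesian_category +
  assumes Proj0_additive: "\<lbrakk>A \<in> Obj X; B \<in> Obj X\<rbrakk> \<Longrightarrow> additive_map X (\<pi>\<^sub>0 A B)"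
    and Proj1_additive: "\<lbrakk>A \<in> Obj X; B \<in> Obj X\<rbrakk> \<Longrightarrow> additive_map X (\<pi>\<^sub>1 A B)"

definition times_map :: "('o, 'm) cla_data \<Rightarrow> 'm \<Rightarrow> 'm \<Rightarrow> 'm"  (infixr "\<^bold>\<otimes>\<index>" 75) where
  "f \<^bold>\<otimes>\<^bsub>X\<^esub> g =
     \<langle>\<pi>\<^sub>0\<^bsub>X\<^esub> (Dom X f) (Dom X g) \<cdot>\<^bsub>X\<^esub> f, \<pi>\<^sub>1\<^bsub>X\<^esub> (Dom X f) (Dom X g) \<cdot>\<^bsub>X\<^esub> g\<rangle>\<^bsub>X\<^esub>"

definition oplus_map :: "('o, 'm) cla_data \<Rightarrow> 'o \<Rightarrow> 'm"  ("\<^bold>\<oplus>\<index>") where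
  "\<^bold>\<oplus>\<^bsub>X\<^esub> A = \<pi>\<^sub>0\<^bsub>X\<^esub> A A \<^bold>+\<^bsub>X\<^esub> \<pi>\<^sub>1\<^bsub>X\<^esub> A A"

definition ell_map :: "('o, 'm) cla_data \<Rightarrow> 'o \<Rightarrow> 'o \<Rightarrow> 'o \<Rightarrow> 'o \<Rightarrow> 'm"  ("\<l>\<index>") where
  "\<l>\<^bsub>X\<^esub> A B C D =
     \<langle>\<^bold>1\<^bsub>X\<^esub> A, \<^bold>0\<^bsub>X\<^esub> A B\<rangle>\<^bsub>X\<^esub> \<^bold>\<otimes>\<^bsub>X\<^esub> \<langle>\<^bold>0\<^bsub>X\<^esub> D C, \<^bold>1\<^bsub>X\<^esub> D\<rangle>\<^bsub>X\<^esub>"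

definition interchange_map :: "('o, 'm) cla_data \<Rightarrow> 'o \<Rightarrow> 'o \<Rightarrow> 'o \<Rightarrow> 'o \<Rightarrow> 'm"  ("\<c>\<index>") where
  "\<c>\<^bsub>X\<^esub> A B C D =
     \<langle>\<pi>\<^sub>0\<^bsub>X\<^esub> A B \<^bold>\<otimes>\<^bsub>X\<^esub> \<pi>\<^sub>0\<^bsub>X\<^esub> C D, \<pi>\<^sub>1\<^bsub>X\<^esub> A B \<^bold>\<otimes>\<^bsub>X\<^esub> \<pi>\<^sub>1\<^bsub>X\<^esub> C D\<rangle>\<^bsub>X\<^esub>"

definition alpha_map :: "('o, 'm) cla_data \<Rightarrow> 'o \<Rightarrow> 'o \<Rightarrow> 'o \<Rightarrow> 'm" where
  "alpha_map X C A B =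
     \<langle>\<^bold>1\<^bsub>X\<^esub> C \<^bold>\<otimes>\<^bsub>X\<^esub> \<pi>\<^sub>0\<^bsub>X\<^esub> A B, \<pi>\<^sub>1\<^bsub>X\<^esub> C (A \<^bold>\<times>\<^bsub>X\<^esub> B) \<cdot>\<^bsub>X\<^esub> \<pi>\<^sub>1\<^bsub>X\<^esub> A B\<rangle>\<^bsub>X\<^esub>"

definition beta_map :: "('o, 'm) cla_data \<Rightarrow> 'o \<Rightarrow> 'o \<Rightarrow> 'o \<Rightarrow> 'm" where
  "beta_map X C A B =
     \<langle>\<^bold>1\<^bsub>X\<^esub> C \<^bold>\<otimes>\<^bsub>X\<^esub> \<pi>\<^sub>1\<^bsub>X\<^esub> A B, \<pi>\<^sub>1\<^bsub>X\<^esub> C (A \<^bold>\<times>\<^bsub>X\<^esub> B) \<cdot>\<^bsub>X\<^esub> \<pi>\<^sub>0\<^bsub>X\<^esub> A B\<rangle>\<^bsub>X\<^esub>"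

text \<open>
  The inverses of \<open>alpha_map\<close> and \<open>beta_map\<close>, written out; see \<open>alpha_map_inverse\<close> and
  \<open>beta_map_inverse\<close> below.
\<close>

definition alpha_inv :: "('o, 'm) cla_data \<Rightarrow> 'o \<Rightarrow> 'o \<Rightarrow> 'o \<Rightarrow> 'm" where
  "alpha_inv X C A B =
     \<langle>\<pi>\<^sub>0\<^bsub>X\<^esub> (C \<^bold>\<times>\<^bsub>X\<^esub> A) B \<cdot>\<^bsub>X\<^esub> \<pi>\<^sub>0\<^bsub>X\<^esub> C A,
      \<langle>\<pi>\<^sub>0\<^bsub>X\<^esub> (C \<^bold>\<times>\<^bsub>X\<^esub> A) B \<cdot>\<^bsub>X\<^esub> \<pi>\<^sub>1\<^bsub>X\<^esub> C A, \<pi>\<^sub>1\<^bsub>X\<^esub> (C \<^bold>\<times>\<^bsub>X\<^esub> A) B\<rangle>\<^bsub>X\<^esub>\<rangle>\<^bsub>X\<^esub>"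

definition beta_inv :: "('o, 'm) cla_data \<Rightarrow> 'o \<Rightarrow> 'o \<Rightarrow> 'o \<Rightarrow> 'm" where
  "beta_inv X C A B =
     \<langle>\<pi>\<^sub>0\<^bsub>X\<^esub> (C \<^bold>\<times>\<^bsub>X\<^esub> B) A \<cdot>\<^bsub>X\<^esub> \<pi>\<^sub>0\<^bsub>X\<^esub> C B,
      \<langle>\<pi>\<^sub>1\<^bsub>X\<^esub> (C \<^bold>\<times>\<^bsub>X\<^esub> B) A, \<pi>\<^sub>0\<^bsub>X\<^esub> (C \<^bold>\<times>\<^bsub>X\<^esub> B) A \<cdot>\<^bsub>X\<^esub> \<pi>\<^sub>1\<^bsub>X\<^esub> C B\<rangle>\<^bsub>X\<^esub>\<rangle>\<^bsub>X\<^esub>"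

context cartesian_category
begin

lemma HomI: "\<lbrakk>f \<in> Arr X; Dom X f = A; Cod X f = B\<rbrakk> \<Longrightarrow> f \<in> Hom A B"
  by (simp add: Hom_def)

lemma Idn_arr: "A \<in> Obj X \<Longrightarrow> \<^bold>1 A \<in> Arr X \<and> Dom X (\<^bold>1 A) = A \<and> Cod X (\<^bold>1 A) = A"
  using Idn_Hom by (simp add: Hom_def)

lemma Comp_arr:
  "\<lbrakk>f \<in> Arr X; g \<in> Arr X; Cod X f = Dom X g\<rbrakk> \<Longrightarrow>
     f \<cdot> g \<in> Arr X \<and> Dom X (f \<cdot> g) = Dom X f \<and> Cod X (f \<cdot> g) = Cod X g"
  using Comp_Hom[of f "Dom X f" "Dom X g" g "Cod X g"] by (simp add: Hom_def)

lemma Proj_arr: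
  assumes "A \<in> Obj X" "B \<in> Obj X"
  shows "\<pi>\<^sub>0 A B \<in> Arr X \<and> Dom X (\<pi>\<^sub>0 A B) = A \<^bold>\<times> B \<and> Cod X (\<pi>\<^sub>0 A B) = A"
    and "\<pi>\<^sub>1 A B \<in> Arr X \<and> Dom X (\<pi>\<^sub>1 A B) = A \<^bold>\<times> B \<and> Cod X (\<pi>\<^sub>1 A B) = B"
  using Proj0_Hom[OF assms] Proj1_Hom[OF assms] by (simp_all add: Hom_def)

lemma Pair_arr:
  "\<lbrakk>f \<in> Arr X; g \<in> Arr X; Dom X f = Dom X g\<rbrakk> \<Longrightarrow>
     \<langle>f, g\<rangle> \<in> Arr X \<and> Dom X \<langle>f, g\<rangle> = Dom X g \<and> Cod X \<langle>f, g\<rangle> = Cod X f \<^bold>\<times> Cod X g"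
  using Pair_Hom[of f "Dom X g" "Cod X f" g "Cod X g"] by (simp add: Hom_def)

lemmas arr_simps = Idn_arr Comp_arr Proj_arr Pair_arr Prod_Obj Dom_Obj Cod_Obj

lemma assoc_arr:
  "\<lbrakk>f \<in> Arr X; g \<in> Arr X; h \<in> Arr X; Cod X f = Dom X g; Cod X g = Dom X h\<rbrakk> \<Longrightarrow>
     (f \<cdot> g) \<cdot> h = f \<cdot> (g \<cdot> h)"
  using Comp_assoc by (metis HomI)

lemma Idn_left_arr: "\<lbrakk>f \<in> Arr X; Dom X f = A\<rbrakk> \<Longrightarrow> \<^bold>1 A \<cdot> f = f"
  and Idn_right_arr: "\<lbrakk>f \<in> Arr X; Cod X f = B\<rbrakk> \<Longrightarrow> f \<cdot> \<^bold>1 B = f"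
  using Comp_Idn_left Comp_Idn_right HomI by blast+

lemma Pair_Proj_arr:
  assumes "f \<in> Arr X" "g \<in> Arr X" "Dom X f = Dom X g" "Cod X f = A" "Cod X g = B"
  shows "\<langle>f, g\<rangle> \<cdot> \<pi>\<^sub>0 A B = f" and "\<langle>f, g\<rangle> \<cdot> \<pi>\<^sub>1 A B = g"
  using assms Pair_Proj0[of f "Dom X g" A g B] Pair_Proj1[of f "Dom X g" A g B]
  by (simp_all add: Hom_def)

lemma Pair_Proj_Comp_arr:
  assumes "f \<in> Arr X" "g \<in> Arr X" "Dom X f = Dom X g" "Cod X f = A" "Cod X g = B"
    and "h \<in> Arr X"
  shows "Dom X h = A \<Longrightarrow> \<langle>f, g\<rangle> \<cdot> (\<pi>\<^sub>0 A B \<cdot> h) = f \<cdot> h"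
    and "Dom X h = B \<Longrightarrow> \<langle>f, g\<rangle> \<cdot> (\<pi>\<^sub>1 A B \<cdot> h) = g \<cdot> h"
proof -
  have [simp]: "A \<in> Obj X" "B \<in> Obj X"
    using assms Cod_Obj by blast+
  note [simp] = arr_simps assms(1-3,6) Pair_Proj_arr[OF assms(1-5)]
  show "\<langle>f, g\<rangle> \<cdot> (\<pi>\<^sub>0 A B \<cdot> h) = f \<cdot> h" if "Dom X h = A"
    using assms that assoc_arr[of "\<langle>f, g\<rangle>" "\<pi>\<^sub>0 A B" h] by simp
  show "\<langle>f, g\<rangle> \<cdot> (\<pi>\<^sub>1 A B \<cdot> h) = g \<cdot> h" if "Dom X h = B"
    using assms that assoc_arr[of "\<langle>f, g\<rangle>" "\<pi>\<^sub>1 A B" h] by simp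
qed

lemma Pair_eta_arr:
  assumes "A \<in> Obj X" "B \<in> Obj X"
  shows "\<langle>\<pi>\<^sub>0 A B, \<pi>\<^sub>1 A B\<rangle> = \<^bold>1 (A \<^bold>\<times> B)"
    and "\<lbrakk>h \<in> Arr X; Cod X h = A \<^bold>\<times> B\<rbrakk> \<Longrightarrow> \<langle>h \<cdot> \<pi>\<^sub>0 A B, h \<cdot> \<pi>\<^sub>1 A B\<rangle> = h"
proof -
  show eta: "\<langle>h \<cdot> \<pi>\<^sub>0 A B, h \<cdot> \<pi>\<^sub>1 A B\<rangle> = h" if "h \<in> Arr X" "Cod X h = A \<^bold>\<times> B" for h
    using Pair_unique[of A B h "Dom X h"] assms that by (simp add: Hom_def)
  show "\<langle>\<pi>\<^sub>0 A B, \<pi>\<^sub>1 A B\<rangle> = \<^bold>1 (A \<^bold>\<times> B)"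
    using eta[of "\<^bold>1 (A \<^bold>\<times> B)"] assms by (simp add: arr_simps Idn_left_arr)
qed

lemma Comp_Pair_arr:
  assumes "f \<in> Arr X" "g \<in> Arr X" "Dom X f = Dom X g" "h \<in> Arr X" "Cod X h = Dom X g"
  shows "h \<cdot> \<langle>f, g\<rangle> = \<langle>h \<cdot> f, h \<cdot> g\<rangle>"
  using Pair_eta_arr(2)[of "Cod X f" "Cod X g" "h \<cdot> \<langle>f, g\<rangle>"] assms
  by (simp add: arr_simps assoc_arr Pair_Proj_arr)

lemmas cartesian_simps = arr_simps assoc_arr Idn_left_arr Idn_right_arr Pair_Proj_arr
  Pair_Proj_Comp_arr Pair_eta_arr Comp_Pair_arr

lemma alpha_map_inverse:
  assumes "C \<in> Obj X" "A \<in> Obj X" "B \<in> Obj X"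
  shows "alpha_map X C A B \<in> Hom (C \<^bold>\<times> (A \<^bold>\<times> B)) ((C \<^bold>\<times> A) \<^bold>\<times> B)"
    and "alpha_inv X C A B \<in> Hom ((C \<^bold>\<times> A) \<^bold>\<times> B) (C \<^bold>\<times> (A \<^bold>\<times> B))"
    and "alpha_map X C A B \<cdot> alpha_inv X C A B = \<^bold>1 (C \<^bold>\<times> (A \<^bold>\<times> B))"
    and "alpha_inv X C A B \<cdot> alpha_map X C A B = \<^bold>1 ((C \<^bold>\<times> A) \<^bold>\<times> B)"
  using assms
  by (simp_all add: Hom_def alpha_map_def alpha_inv_def times_map_def cartesian_simps)

lemma beta_map_inverse:
  assumes "C \<in> Obj X" "A \<in> Obj X" "B \<in> Obj X"
  shows "beta_map X C A B \<in> Hom (C \<^bold>\<times> (A \<^bold>\<times> B)) ((C \<^bold>\<times> B) \<^bold>\<times> A)"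
    and "beta_inv X C A B \<in> Hom ((C \<^bold>\<times> B) \<^bold>\<times> A) (C \<^bold>\<times> (A \<^bold>\<times> B))"
    and "beta_map X C A B \<cdot> beta_inv X C A B = \<^bold>1 (C \<^bold>\<times> (A \<^bold>\<times> B))"
    and "beta_inv X C A B \<cdot> beta_map X C A B = \<^bold>1 ((C \<^bold>\<times> B) \<^bold>\<times> A)"
  using assms
  by (simp_all add: Hom_def beta_map_def beta_inv_def times_map_def cartesian_simps)

end

locale differential_combinator =
  fixes X :: "('o, 'm) cla_data" (structure)
    and D :: "'m \<Rightarrow> 'm"
  assumes D_type: "D \<in> (\<Pi>\<^sub>E f \<in> Arr X. Hom (Dom X f \<^bold>\<times> Dom X f) (Cod X f))"
    and CD1_Add: "\<lbrakk>f \<in> Hom A B; g \<in> Hom A B\<rbrakk> \<Longrightarrow> D (f \<^bold>+ g) = D f \<^bold>+ D g"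
    and CD1_Zero: "\<lbrakk>A \<in> Obj X; B \<in> Obj X\<rbrakk> \<Longrightarrow> D (\<^bold>0 A B) = \<^bold>0 (A \<^bold>\<times> A) B"
    and CD2_Add: "f \<in> Hom A B \<Longrightarrow>
          (\<^bold>1 A \<^bold>\<otimes> \<^bold>\<oplus> A) \<cdot> D f = (\<^bold>1 A \<^bold>\<otimes> \<pi>\<^sub>0 A A) \<cdot> D f \<^bold>+ (\<^bold>1 A \<^bold>\<otimes> \<pi>\<^sub>1 A A) \<cdot> D f"
    and CD2_Zero: "f \<in> Hom A B \<Longrightarrow> \<langle>\<^bold>1 A, \<^bold>0 A A\<rangle> \<cdot> D f = \<^bold>0 A B"
    and CD3_Idn: "A \<in> Obj X \<Longrightarrow> D (\<^bold>1 A) = \<pi>\<^sub>1 A A"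
    and CD3_Proj0: "\<lbrakk>A \<in> Obj X; B \<in> Obj X\<rbrakk> \<Longrightarrow>
          D (\<pi>\<^sub>0 A B) = \<pi>\<^sub>1 (A \<^bold>\<times> B) (A \<^bold>\<times> B) \<cdot> \<pi>\<^sub>0 A B"
    and CD3_Proj1: "\<lbrakk>A \<in> Obj X; B \<in> Obj X\<rbrakk> \<Longrightarrow>
          D (\<pi>\<^sub>1 A B) = \<pi>\<^sub>1 (A \<^bold>\<times> B) (A \<^bold>\<times> B) \<cdot> \<pi>\<^sub>1 A B"
    and CD4: "\<lbrakk>f \<in> Hom C A; g \<in> Hom C B\<rbrakk> \<Longrightarrow> D \<langle>f, g\<rangle> = \<langle>D f, D g\<rangle>"
    and CD5: "\<lbrakk>f \<in> Hom A B; g \<in> Hom B C\<rbrakk> \<Longrightarrow> D (f \<cdot> g) = \<langle>\<pi>\<^sub>0 A A \<cdot> f, D f\<rangle> \<cdot> D g"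
    and CD6: "f \<in> Hom A B \<Longrightarrow> \<l> A A A A \<cdot> D (D f) = D f"
    and CD7: "f \<in> Hom A B \<Longrightarrow> \<c> A A A A \<cdot> D (D f) = D (D f)"

locale cartesian_differential_category =
  cartesian_left_additive_category X + differential_combinator X D
  for X :: "('o, 'm) cla_data" (structure) and D

text \<open>
  A family \<open>L\<close> takes the context object \<open>C\<close> and the object \<open>A\<close> as arguments, because neither is
  determined by the object \<open>C \<^bold>\<times> A\<close> on which the arrow is defined.
\<close>

definition lin0 :: "('o, 'm) cla_data \<Rightarrow> ('o \<Rightarrow> 'o \<Rightarrow> 'm \<Rightarrow> 'm) \<Rightarrow> 'o \<Rightarrow> 'o \<Rightarrow> 'o \<Rightarrow> 'm \<Rightarrow> 'm" where
  "lin0 X L C A B f =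
     beta_map X C A B \<cdot>\<^bsub>X\<^esub> L (C \<^bold>\<times>\<^bsub>X\<^esub> B) A (beta_inv X C A B \<cdot>\<^bsub>X\<^esub> f)"

definition lin1 :: "('o, 'm) cla_data \<Rightarrow> ('o \<Rightarrow> 'o \<Rightarrow> 'm \<Rightarrow> 'm) \<Rightarrow> 'o \<Rightarrow> 'o \<Rightarrow> 'o \<Rightarrow> 'm \<Rightarrow> 'm" where
  "lin1 X L C A B f =
     alpha_map X C A B \<cdot>\<^bsub>X\<^esub> L (C \<^bold>\<times>\<^bsub>X\<^esub> A) B (alpha_inv X C A B \<cdot>\<^bsub>X\<^esub> f)"

locale linearizing_system =
  fixes X :: "('o, 'm) cla_data" (structure)
    and L :: "'o \<Rightarrow> 'o \<Rightarrow> 'm \<Rightarrow> 'm"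
  assumes L_type: "L \<in> (\<Pi>\<^sub>E C \<in> Obj X. \<Pi>\<^sub>E A \<in> Obj X.
          \<Pi>\<^sub>E f \<in> {f \<in> Arr X. Dom X f = C \<^bold>\<times> A}. Hom (C \<^bold>\<times> A) (Cod X f))"
    and L1_Add: "\<lbrakk>C \<in> Obj X; A \<in> Obj X; f \<in> Hom (C \<^bold>\<times> A) B; g \<in> Hom (C \<^bold>\<times> A) B\<rbrakk> \<Longrightarrow>
          L C A (f \<^bold>+ g) = L C A f \<^bold>+ L C A g"
    and L1_Zero: "\<lbrakk>C \<in> Obj X; A \<in> Obj X; B \<in> Obj X\<rbrakk> \<Longrightarrow>
          L C A (\<^bold>0 (C \<^bold>\<times> A) B) = \<^bold>0 (C \<^bold>\<times> A) B"
    and L2_Add: "\<lbrakk>C \<in> Obj X; A \<in> Obj X; f \<in> Hom (C \<^bold>\<times> A) B\<rbrakk> \<Longrightarrow>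
          (\<^bold>1 C \<^bold>\<otimes> \<^bold>\<oplus> A) \<cdot> L C A f
          = (\<^bold>1 C \<^bold>\<otimes> \<pi>\<^sub>0 A A) \<cdot> L C A f \<^bold>+ (\<^bold>1 C \<^bold>\<otimes> \<pi>\<^sub>1 A A) \<cdot> L C A f"
    and L2_Zero: "\<lbrakk>C \<in> Obj X; A \<in> Obj X; f \<in> Hom (C \<^bold>\<times> A) B\<rbrakk> \<Longrightarrow>
          \<langle>\<pi>\<^sub>0 C A, \<^bold>0 (C \<^bold>\<times> A) A\<rangle> \<cdot> L C A f = \<^bold>0 (C \<^bold>\<times> A) B"
    and L3_Proj1: "\<lbrakk>C \<in> Obj X; A \<in> Obj X\<rbrakk> \<Longrightarrow> L C A (\<pi>\<^sub>1 C A) = \<pi>\<^sub>1 C A"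
    and L3_Proj1_Proj0: "\<lbrakk>C \<in> Obj X; A \<in> Obj X; B \<in> Obj X\<rbrakk> \<Longrightarrow>
          L C (A \<^bold>\<times> B) (\<pi>\<^sub>1 C (A \<^bold>\<times> B) \<cdot> \<pi>\<^sub>0 A B) = \<pi>\<^sub>1 C (A \<^bold>\<times> B) \<cdot> \<pi>\<^sub>0 A B"
    and L3_Proj1_Proj1: "\<lbrakk>C \<in> Obj X; A \<in> Obj X; B \<in> Obj X\<rbrakk> \<Longrightarrow>
          L C (A \<^bold>\<times> B) (\<pi>\<^sub>1 C (A \<^bold>\<times> B) \<cdot> \<pi>\<^sub>1 A B) = \<pi>\<^sub>1 C (A \<^bold>\<times> B) \<cdot> \<pi>\<^sub>1 A B"
    and L4: "\<lbrakk>C \<in> Obj X; A \<in> Obj X; f \<in> Hom (C \<^bold>\<times> A) B; g \<in> Hom (C \<^bold>\<times> A) B'\<rbrakk> \<Longrightarrow>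
          L C A \<langle>f, g\<rangle> = \<langle>L C A f, L C A g\<rangle>"
    and L5: "\<lbrakk>C \<in> Obj X; A \<in> Obj X; B \<in> Obj X; f \<in> Hom (C \<^bold>\<times> A) B; g \<in> Hom (C \<^bold>\<times> B) E\<rbrakk> \<Longrightarrow>
          L C A (\<langle>\<pi>\<^sub>0 C A, f\<rangle> \<cdot> g)
          = \<langle>\<pi>\<^sub>0 C A, L C A f\<rangle>
            \<cdot> L C B (\<langle>\<pi>\<^sub>0 C B, \<pi>\<^sub>1 C B \<^bold>+ \<langle>\<pi>\<^sub>0 C B, \<^bold>0 (C \<^bold>\<times> B) A\<rangle> \<cdot> f\<rangle> \<cdot> g)"
    and L6: "\<lbrakk>C \<in> Obj X; A \<in> Obj X; f \<in> Hom (C \<^bold>\<times> A) B\<rbrakk> \<Longrightarrow> L C A (L C A f) = L C A f"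
    and L7: "\<lbrakk>C \<in> Obj X; A \<in> Obj X; B \<in> Obj X; f \<in> Hom (C \<^bold>\<times> (A \<^bold>\<times> B)) E\<rbrakk> \<Longrightarrow>
          lin1 X L C A B (lin0 X L C A B f) = lin0 X L C A B (lin1 X L C A B f)"
    and L8: "\<lbrakk>h \<in> Hom C' C; A \<in> Obj X; f \<in> Hom (C \<^bold>\<times> A) B\<rbrakk> \<Longrightarrow>
          (h \<^bold>\<otimes> \<^bold>1 A) \<cdot> L C A f = L C' A ((h \<^bold>\<otimes> \<^bold>1 A) \<cdot> f)"

text \<open>
  The two directions of the correspondence: linearization is partial differentiation at zero,
  \<open>\<l> \<cdot> D f\<close>, and the derivative of \<open>f\<close> at \<open>x\<close> is the linearization of
  \<open>y \<mapsto> f (x + y)\<close> in context \<open>x\<close>. Both are made extensional, so that equality of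
  combinators is equality of families of operators.
\<close>

definition linearization :: "('o, 'm) cla_data \<Rightarrow> ('m \<Rightarrow> 'm) \<Rightarrow> 'o \<Rightarrow> 'o \<Rightarrow> 'm \<Rightarrow> 'm" where
  "linearization X D =
     (\<lambda>C\<in>Obj X. \<lambda>A\<in>Obj X. \<lambda>f\<in>{f \<in> Arr X. Dom X f = C \<^bold>\<times>\<^bsub>X\<^esub> A}. \<l>\<^bsub>X\<^esub> C A C A \<cdot>\<^bsub>X\<^esub> D f)"

definition differentiation :: "('o, 'm) cla_data \<Rightarrow> ('o \<Rightarrow> 'o \<Rightarrow> 'm \<Rightarrow> 'm) \<Rightarrow> 'm \<Rightarrow> 'm" where
  "differentiation X L = (\<lambda>f\<in>Arr X. L (Dom X f) (Dom X f) (\<^bold>\<oplus>\<^bsub>X\<^esub> (Dom X f) \<cdot>\<^bsub>X\<^esub> f))"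

end

theory Submission
  imports Defs
begin

text \<open>
  Read an arrow as a function and a composite \<open>x \<cdot> f\<close> as its value at a generalized element
  \<open>x\<close>. A derivative then has values \<open>D[f](x, y)\<close>, additive in the direction \<open>y\<close>, and a
  linearization has values \<open>L[f](c, a)\<close>, additive in \<open>a\<close>. The two passages are
  \<open>L[f](c, a) = D[f]((c, 0), (0, a))\<close> and \<open>D[f](x, y) = L[z \<mapsto> f(x + z)](y)\<close>, where the second
  linearization is taken in the context \<open>x\<close>.

  From \<open>D\<close> to \<open>L\<close>, every axiom is an evaluation: the chain rule and the rules for the structure
  maps reduce both sides to values of \<open>D[f]\<close> and \<open>D[D[f]]\<close>. Idempotence of linearization is the
  lift rule CD6. The two partial linearizations of \<open>f\<close> are, in either order, values of \<open>D[D[f]]\<close>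
  that differ by the interchange of CD7.

  From \<open>L\<close> to \<open>D\<close>, three consequences of the axioms carry the argument. A map that depends on the
  context only has linearization \<open>0\<close> (\<open>L_context_only\<close>). Linearization commutes with
  substitution along a map that is its own linearization (\<open>L_linear_substitution\<close>, a case of L5).
  By L8, the translated map \<open>z \<mapsto> f(h(t) + z)\<close> has linearization \<open>D[f](h(t), z)\<close>
  (\<open>differentiation_substitute\<close>). The last two recover \<open>L\<close> from \<open>D\<close>, and CD6 for a derivative
  then becomes idempotence L6. The chain rule is L5, whose right-hand side translates \<open>g\<close> by
  \<open>f(x)\<close>.

  The real work is CD7. Additivity in the outer direction splits the second derivative as
  \<open>D[D[f]]((x, y), (z, w)) = D\<^sup>2f(x)(y, z) + D[f](x, w)\<close>, where \<open>D\<^sup>2f(x)(y, z)\<close> differentiates the base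
  point of \<open>D[f](x, y)\<close> in the direction \<open>z\<close>. Linearizing \<open>f(x + a + b)\<close> in \<open>b\<close> and then in \<open>a\<close>
  gives \<open>D\<^sup>2f\<close>, and the opposite order gives \<open>D\<^sup>2f\<close> with its two directions exchanged, so L7 is
  exactly the symmetry required.
\<close>

section \<open>Calculating in a Cartesian left additive category\<close>

context cartesian_left_additive_category
begin

lemma Zero_arr:
  assumes "A \<in> Obj X" "B \<in> Obj X"
  shows "\<^bold>0 A B \<in> Arr X \<and> Dom X (\<^bold>0 A B) = A \<and> Cod X (\<^bold>0 A B) = B"
  using monoid.one_closed[OF comm_monoid.axioms(1)[OF Hom_comm_monoid[OF assms]]]
  by (simp add: Hom_monoid_def Hom_def)

lemma Add_arr:
  assumes "f \<in> Arr X" "g \<in> Arr X" "Dom X f = Dom X g" "Cod X f = Cod X g"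
  shows "f \<^bold>+ g \<in> Arr X \<and> Dom X (f \<^bold>+ g) = Dom X g \<and> Cod X (f \<^bold>+ g) = Cod X g"
  using monoid.m_closed[OF comm_monoid.axioms(1)[OF Hom_comm_monoid[of "Dom X g" "Cod X g"]], of f g]
    assms Dom_Obj[of g] Cod_Obj[of g]
  by (simp add: Hom_monoid_def Hom_def)

lemma Add_assoc_arr:
  assumes "f \<in> Arr X" "g \<in> Arr X" "h \<in> Arr X" "Dom X f = Dom X g" "Cod X f = Cod X g"
    "Dom X g = Dom X h" "Cod X g = Cod X h"
  shows "f \<^bold>+ g \<^bold>+ h = f \<^bold>+ (g \<^bold>+ h)"
  using monoid.m_assoc[OF comm_monoid.axioms(1)[OF Hom_comm_monoid[of "Dom X h" "Cod X h"]], of f g h]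
    assms Dom_Obj[of h] Cod_Obj[of h]
  by (simp add: Hom_monoid_def Hom_def)

lemma Add_commute_arr:
  assumes "f \<in> Arr X" "g \<in> Arr X" "Dom X f = Dom X g" "Cod X f = Cod X g"
  shows "f \<^bold>+ g = g \<^bold>+ f"
  using comm_monoid.m_comm[OF Hom_comm_monoid[of "Dom X g" "Cod X g"], of f g]
    assms Dom_Obj[of g] Cod_Obj[of g]
  by (simp add: Hom_monoid_def Hom_def)

lemma Add_Zero_arr:
  assumes "f \<in> Arr X" "Dom X f = A" "Cod X f = B"
  shows "\<^bold>0 A B \<^bold>+ f = f" and "f \<^bold>+ \<^bold>0 A B = f"
  using monoid.l_one[OF comm_monoid.axioms(1)[OF Hom_comm_monoid[of A B]], of f]
    monoid.r_one[OF comm_monoid.axioms(1)[OF Hom_comm_monoid[of A B]], of f]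
    assms Dom_Obj[of f] Cod_Obj[of f]
  by (auto simp add: Hom_monoid_def Hom_def)

lemma Comp_Add_arr:
  assumes "h \<in> Arr X" "f \<in> Arr X" "g \<in> Arr X" "Cod X h = Dom X g" "Dom X f = Dom X g"
    "Cod X f = Cod X g"
  shows "h \<cdot> (f \<^bold>+ g) = h \<cdot> f \<^bold>+ h \<cdot> g"
  using assms Comp_Add[of h "Dom X h" "Dom X g" f "Cod X g" g] by (simp add: Hom_def)

lemma Comp_Zero_arr:
  assumes "h \<in> Arr X" "Cod X h = B" "C \<in> Obj X"
  shows "h \<cdot> \<^bold>0 B C = \<^bold>0 (Dom X h) C"
  using assms Comp_Zero[of h "Dom X h" B C] by (simp add: Hom_def)

lemma Proj_additive_arr:
  assumes "f \<in> Arr X" "g \<in> Arr X" "Dom X f = Dom X g" "Cod X f = A \<^bold>\<times> B" "Cod X g = A \<^bold>\<times> B"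
    "A \<in> Obj X" "B \<in> Obj X"
  shows "(f \<^bold>+ g) \<cdot> \<pi>\<^sub>0 A B = f \<cdot> \<pi>\<^sub>0 A B \<^bold>+ g \<cdot> \<pi>\<^sub>0 A B"
    and "(f \<^bold>+ g) \<cdot> \<pi>\<^sub>1 A B = f \<cdot> \<pi>\<^sub>1 A B \<^bold>+ g \<cdot> \<pi>\<^sub>1 A B"
  using Proj0_additive[of A B] Proj1_additive[of A B] assms Dom_Obj[of g] Proj_arr[of A B]
  unfolding additive_map_def Hom_def by auto

lemma Zero_Proj_arr:
  assumes "A \<in> Obj X" "B \<in> Obj X" "T \<in> Obj X"
  shows "\<^bold>0 T (A \<^bold>\<times> B) \<cdot> \<pi>\<^sub>0 A B = \<^bold>0 T A"
    and "\<^bold>0 T (A \<^bold>\<times> B) \<cdot> \<pi>\<^sub>1 A B = \<^bold>0 T B"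
  using Proj0_additive[of A B] Proj1_additive[of A B] assms Proj_arr[of A B]
  unfolding additive_map_def by auto

lemmas additive_simps0 = cartesian_simps Zero_arr Add_arr Add_Zero_arr Comp_Add_arr
  Comp_Zero_arr Proj_additive_arr Zero_Proj_arr

lemma Pair_Add_arr:
  assumes "f \<in> Arr X" "g \<in> Arr X" "f' \<in> Arr X" "g' \<in> Arr X"
    "Dom X f = Dom X g'" "Dom X g = Dom X g'" "Dom X f' = Dom X g'"
    "Cod X f = Cod X f'" "Cod X g = Cod X g'"
  shows "\<langle>f, g\<rangle> \<^bold>+ \<langle>f', g'\<rangle> = \<langle>f \<^bold>+ f', g \<^bold>+ g'\<rangle>"
  using assms Pair_eta_arr(2)[of "Cod X f'" "Cod X g'" "\<langle>f, g\<rangle> \<^bold>+ \<langle>f', g'\<rangle>"]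
  by (simp add: additive_simps0)

text \<open>
  Oriented towards \<open>0\<close> so that CD6, and additivity at \<open>0\<close>, still match when an argument of
  \<open>D f\<close> lies in a product.
\<close>

lemma Pair_Zero_arr:
  assumes "A \<in> Obj X" "B \<in> Obj X" "T \<in> Obj X"
  shows "\<langle>\<^bold>0 T A, \<^bold>0 T B\<rangle> = \<^bold>0 T (A \<^bold>\<times> B)"
  using assms Pair_eta_arr(2)[of A B "\<^bold>0 T (A \<^bold>\<times> B)"]
  by (simp add: additive_simps0)

text \<open>
  Composites are kept associated to the right, so distributivity over pairs and sums also
  needs a form in which the pair or the sum is followed by a further arrow.
\<close>

lemma Comp_distrib_Comp_arr:
  assumes "h \<in> Arr X" "f \<in> Arr X" "g \<in> Arr X" "k \<in> Arr X" "Cod X h = Dom X g" "Dom X f = Dom X g"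
  shows "Cod X f \<^bold>\<times> Cod X g = Dom X k \<Longrightarrow> h \<cdot> (\<langle>f, g\<rangle> \<cdot> k) = \<langle>h \<cdot> f, h \<cdot> g\<rangle> \<cdot> k"
    and "\<lbrakk>Cod X f = Cod X g; Cod X g = Dom X k\<rbrakk> \<Longrightarrow> h \<cdot> ((f \<^bold>+ g) \<cdot> k) = (h \<cdot> f \<^bold>+ h \<cdot> g) \<cdot> k"
  using assms
  by (simp_all add: additive_simps0 assoc_arr[symmetric] del: assoc_arr)

lemmas additive_simps = additive_simps0 Comp_distrib_Comp_arr Pair_Add_arr Pair_Zero_arr

lemmas structure_defs = times_map_def oplus_map_def ell_map_def interchange_map_def
  alpha_map_def beta_map_def alpha_inv_def beta_inv_def

end

section \<open>A differential combinator linearizes\<close>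

context cartesian_differential_category
begin

lemma D_arr: "f \<in> Arr X \<Longrightarrow> D f \<in> Arr X \<and> Dom X (D f) = Dom X f \<^bold>\<times> Dom X f \<and> Cod X (D f) = Cod X f"
  using D_type by (auto simp: Hom_def PiE_def Pi_def)

text \<open>
  The axioms evaluated at generalized elements. In this form they are oriented rewrite rules that
  compute the value of an iterated derivative from the outside in; only the interchange rule, which
  is a permutation of arguments, is applied separately.
\<close>

lemma D_add_at:
  assumes "x \<in> Arr X" "y \<in> Arr X" "z \<in> Arr X" "f \<in> Arr X" "Dom X x = Dom X z" "Dom X y = Dom X z"
    "Cod X x = Dom X f" "Cod X y = Dom X f" "Cod X z = Dom X f"
  shows "\<langle>x, y \<^bold>+ z\<rangle> \<cdot> D f = \<langle>x, y\<rangle> \<cdot> D f \<^bold>+ \<langle>x, z\<rangle> \<cdot> D f"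
  using assms arg_cong[OF CD2_Add[of f "Dom X f" "Cod X f"], of "\<lambda>k. \<langle>x, \<langle>y, z\<rangle>\<rangle> \<cdot> k"]
  by (simp add: additive_simps structure_defs D_arr Hom_def)

lemma D_zero_at:
  assumes "x \<in> Arr X" "f \<in> Arr X" "Cod X x = Dom X f" "T = Dom X x" "A = Dom X f"
  shows "\<langle>x, \<^bold>0 T A\<rangle> \<cdot> D f = \<^bold>0 T (Cod X f)"
  using assms arg_cong[OF CD2_Zero[of f "Dom X f" "Cod X f"], of "\<lambda>k. x \<cdot> k"]
  by (simp add: additive_simps structure_defs D_arr Hom_def)

lemma D_structure_at:
  assumes "x \<in> Arr X" "y \<in> Arr X" "Dom X x = Dom X y" "Cod X x = Cod X y"
  shows "\<lbrakk>Cod X y = A; B \<in> Obj X\<rbrakk> \<Longrightarrow> \<langle>x, y\<rangle> \<cdot> D (\<^bold>0 A B) = \<^bold>0 (Dom X y) B"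
    and "\<lbrakk>Cod X y = A \<^bold>\<times> B; A \<in> Obj X; B \<in> Obj X\<rbrakk> \<Longrightarrow> \<langle>x, y\<rangle> \<cdot> D (\<pi>\<^sub>0 A B) = y \<cdot> \<pi>\<^sub>0 A B"
    and "\<lbrakk>Cod X y = A \<^bold>\<times> B; A \<in> Obj X; B \<in> Obj X\<rbrakk> \<Longrightarrow> \<langle>x, y\<rangle> \<cdot> D (\<pi>\<^sub>1 A B) = y \<cdot> \<pi>\<^sub>1 A B"
  using assms Cod_Obj[of y]
  by (auto simp: CD1_Zero CD3_Proj0 CD3_Proj1 additive_simps)

lemma D_operations_at:
  assumes "x \<in> Arr X" "y \<in> Arr X" "Dom X x = Dom X y" "Cod X x = Dom X f" "Cod X y = Dom X f"
    "f \<in> Arr X" "g \<in> Arr X"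
  shows "Cod X f = Dom X g \<Longrightarrow> \<langle>x, y\<rangle> \<cdot> D (f \<cdot> g) = \<langle>x \<cdot> f, \<langle>x, y\<rangle> \<cdot> D f\<rangle> \<cdot> D g"
    and "Dom X f = Dom X g \<Longrightarrow> \<langle>x, y\<rangle> \<cdot> D \<langle>f, g\<rangle> = \<langle>\<langle>x, y\<rangle> \<cdot> D f, \<langle>x, y\<rangle> \<cdot> D g\<rangle>"
    and "\<lbrakk>Dom X f = Dom X g; Cod X f = Cod X g\<rbrakk>
      \<Longrightarrow> \<langle>x, y\<rangle> \<cdot> D (f \<^bold>+ g) = \<langle>x, y\<rangle> \<cdot> D f \<^bold>+ \<langle>x, y\<rangle> \<cdot> D g"
  using assms CD5[of f "Dom X f" "Cod X f" g "Cod X g"] CD4[of f "Dom X f" "Cod X f" g "Cod X g"]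
    CD1_Add[of f "Dom X f" "Cod X f" g]
  by (simp_all add: Hom_def additive_simps D_arr)

lemma DD_lift_at:
  assumes "x \<in> Arr X" "y \<in> Arr X" "f \<in> Arr X" "Dom X x = Dom X y" "Cod X x = Dom X f"
    "Cod X y = Dom X f" "T = Dom X y" "A = Dom X f"
  shows "\<langle>\<langle>x, \<^bold>0 T A\<rangle>, \<langle>\<^bold>0 T A, y\<rangle>\<rangle> \<cdot> D (D f) = \<langle>x, y\<rangle> \<cdot> D f"
  using assms arg_cong[OF CD6[of f "Dom X f" "Cod X f"], of "\<lambda>k. \<langle>x, y\<rangle> \<cdot> k"]
  by (simp add: additive_simps structure_defs D_arr Hom_def)

lemma DD_swap_at:
  assumes "x \<in> Arr X" "y \<in> Arr X" "z \<in> Arr X" "w \<in> Arr X" "f \<in> Arr X"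
    "Dom X x = Dom X w" "Dom X y = Dom X w" "Dom X z = Dom X w"
    "Cod X x = Dom X f" "Cod X y = Dom X f" "Cod X z = Dom X f" "Cod X w = Dom X f"
  shows "\<langle>\<langle>x, y\<rangle>, \<langle>z, w\<rangle>\<rangle> \<cdot> D (D f) = \<langle>\<langle>x, z\<rangle>, \<langle>y, w\<rangle>\<rangle> \<cdot> D (D f)"
  using assms arg_cong[OF CD7[of f "Dom X f" "Cod X f"], of "\<lambda>k. \<langle>\<langle>x, z\<rangle>, \<langle>y, w\<rangle>\<rangle> \<cdot> k"]
  by (simp add: additive_simps structure_defs D_arr Hom_def)

lemmas derivative_simps = D_arr D_add_at D_zero_at D_structure_at D_operations_at DD_lift_at

lemma linearization_eq:
  assumes "C \<in> Obj X" "A \<in> Obj X" "f \<in> Arr X" "Dom X f = C \<^bold>\<times> A"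
  shows "linearization X D C A f
    = \<langle>\<langle>\<pi>\<^sub>0 C A, \<^bold>0 (C \<^bold>\<times> A) A\<rangle>, \<langle>\<^bold>0 (C \<^bold>\<times> A) C, \<pi>\<^sub>1 C A\<rangle>\<rangle> \<cdot> D f"
  using assms by (simp add: linearization_def additive_simps structure_defs D_arr)

text \<open>
  Both sides evaluate to values of \<open>D[D[f]]\<close>, one at
  \<open>(((c, 0, 0), (0, a, 0)), ((0, 0, b), 0))\<close> and the other with the two middle arguments exchanged.
\<close>

lemma partial_linearizations_commute:
  assumes "C \<in> Obj X" "A \<in> Obj X" "B \<in> Obj X" "f \<in> Arr X" "Dom X f = C \<^bold>\<times> (A \<^bold>\<times> B)"
  shows "lin1 X (linearization X D) C A B (lin0 X (linearization X D) C A B f)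
    = lin0 X (linearization X D) C A B (lin1 X (linearization X D) C A B f)"
  using assms
  by (simp add: lin0_def lin1_def linearization_eq additive_simps structure_defs derivative_simps
      DD_swap_at)

lemma linearization_linearizing: "linearizing_system X (linearization X D)"
proof (unfold_locales, goal_cases)
  case 1
  show ?case
    by (auto simp: linearization_def additive_simps structure_defs D_arr Hom_def intro!: restrict_PiE)
next
  (* Additivity needs an instance: the simplifier has already merged the sum into the pair
     \<langle>0, b\<rangle>, which therefore has to be split again. *)
  case (4 C A f B)
  then show ?case
    using D_add_at[of "\<langle>\<pi>\<^sub>0 C (A \<^bold>\<times> A), \<^bold>0 (C \<^bold>\<times> (A \<^bold>\<times> A)) A\<rangle>"
        "\<langle>\<^bold>0 (C \<^bold>\<times> (A \<^bold>\<times> A)) C, \<pi>\<^sub>1 C (A \<^bold>\<times> A) \<cdot> \<pi>\<^sub>0 A A\<rangle>"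
        "\<langle>\<^bold>0 (C \<^bold>\<times> (A \<^bold>\<times> A)) C, \<pi>\<^sub>1 C (A \<^bold>\<times> A) \<cdot> \<pi>\<^sub>1 A A\<rangle>" f]
    by (simp add: linearization_eq additive_simps structure_defs derivative_simps Hom_def)
next
  case (12 C A B f E)
  then show ?case
    by (intro partial_linearizations_commute) (auto simp: Hom_def)
qed (simp_all add: linearization_eq additive_simps structure_defs derivative_simps Hom_def)

text \<open>
  By the chain rule, the derivative of \<open>f(x + z)\<close> at \<open>((x, 0), (0, y))\<close> is that of \<open>f\<close> at
  \<open>(x + 0, 0 + y)\<close>.
\<close>

lemma differentiation_linearization: "differentiation X (linearization X D) = D"
proof
  fix f
  show "differentiation X (linearization X D) f = D f"
    using D_type
    by (cases "f \<in> Arr X")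
      (auto simp: differentiation_def linearization_eq additive_simps structure_defs derivative_simps
        PiE_def extensional_def)
qed

end

section \<open>A system of linearizing combinators differentiates\<close>

locale cartesian_linearizing_category =
  cartesian_left_additive_category X + linearizing_system X L
  for X :: "('o, 'm) cla_data" (structure) and L
begin

lemma L_arr:
  assumes "f \<in> Arr X" "Dom X f = C \<^bold>\<times> A" "C \<in> Obj X" "A \<in> Obj X"
  shows "L C A f \<in> Arr X \<and> Dom X (L C A f) = C \<^bold>\<times> A \<and> Cod X (L C A f) = Cod X f"
  using PiE_mem[OF PiE_mem[OF PiE_mem[OF L_type assms(3)] assms(4)], of f] assms
  by (simp add: Hom_def)

lemma L_add_at:
  assumes "x \<in> Arr X" "y \<in> Arr X" "z \<in> Arr X" "f \<in> Arr X" "Dom X x = Dom X z" "Dom X y = Dom X z"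
    "Cod X x = C" "Cod X y = A" "Cod X z = A" "Dom X f = C \<^bold>\<times> A"
  shows "\<langle>x, y \<^bold>+ z\<rangle> \<cdot> L C A f = \<langle>x, y\<rangle> \<cdot> L C A f \<^bold>+ \<langle>x, z\<rangle> \<cdot> L C A f"
  using assms Cod_Obj[of x] Cod_Obj[of z]
    arg_cong[OF L2_Add[of C A f "Cod X f"], of "\<lambda>k. \<langle>x, \<langle>y, z\<rangle>\<rangle> \<cdot> k"]
  by (simp add: additive_simps structure_defs L_arr Hom_def)

lemma L_zero_at:
  assumes "x \<in> Arr X" "f \<in> Arr X" "Cod X x = C" "Dom X f = C \<^bold>\<times> A" "A \<in> Obj X" "T = Dom X x"
  shows "\<langle>x, \<^bold>0 T A\<rangle> \<cdot> L C A f = \<^bold>0 T (Cod X f)"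
  using assms Cod_Obj[of x] Dom_Obj[of x]
    arg_cong[OF L2_Zero[of C A f "Cod X f"], of "\<lambda>k. \<langle>x, \<^bold>0 T A\<rangle> \<cdot> k"]
  by (simp add: additive_simps L_arr Hom_def)

lemma L_Add_arr:
  assumes "f \<in> Arr X" "g \<in> Arr X" "Dom X f = C \<^bold>\<times> A" "Dom X g = C \<^bold>\<times> A" "Cod X f = Cod X g"
    "C \<in> Obj X" "A \<in> Obj X"
  shows "L C A (f \<^bold>+ g) = L C A f \<^bold>+ L C A g"
  using assms L1_Add[of C A f "Cod X g" g] by (simp add: Hom_def)

lemma L_Pair_arr:
  assumes "f \<in> Arr X" "g \<in> Arr X" "Dom X f = C \<^bold>\<times> A" "Dom X g = C \<^bold>\<times> A" "C \<in> Obj X" "A \<in> Obj X"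
  shows "L C A \<langle>f, g\<rangle> = \<langle>L C A f, L C A g\<rangle>"
  using assms L4[of C A f "Cod X f" g "Cod X g"] by (simp add: Hom_def)

lemma L_substitute_context:
  assumes "h \<in> Arr X" "Dom X h = C'" "Cod X h = C" "f \<in> Arr X" "Dom X f = C \<^bold>\<times> A" "A \<in> Obj X"
  shows "L C' A (\<langle>\<pi>\<^sub>0 C' A \<cdot> h, \<pi>\<^sub>1 C' A\<rangle> \<cdot> f) = \<langle>\<pi>\<^sub>0 C' A \<cdot> h, \<pi>\<^sub>1 C' A\<rangle> \<cdot> L C A f"
  using assms L8[of h C' C A f "Cod X f"] Dom_Obj[of h]
  by (simp add: Hom_def times_map_def additive_simps)

text \<open>
  A map that ignores its argument does not change when the zero map is substituted for that
  argument, so by L5 its linearization factors through the zero map too, where it vanishes.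
\<close>

lemma L_context_only:
  assumes "h \<in> Arr X" "Dom X h = C" "A \<in> Obj X"
  shows "L C A (\<pi>\<^sub>0 C A \<cdot> h) = \<^bold>0 (C \<^bold>\<times> A) (Cod X h)"
  using assms Dom_Obj[of h] L5[of C A A "\<^bold>0 (C \<^bold>\<times> A) A" "\<pi>\<^sub>0 C A \<cdot> h" "Cod X h"] L1_Zero[of C A A]
  by (simp add: Hom_def additive_simps L_arr L_zero_at)

text \<open>
  A map that is its own linearization preserves zero, so the translation by \<open>f(0)\<close> in L5 is
  trivial.
\<close>

lemma L_linear_substitution:
  assumes "f \<in> Arr X" "Dom X f = C \<^bold>\<times> A" "Cod X f = B" "C \<in> Obj X" "A \<in> Obj X" "L C A f = f"
    "g \<in> Arr X" "Dom X g = C \<^bold>\<times> B"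
  shows "L C A (\<langle>\<pi>\<^sub>0 C A, f\<rangle> \<cdot> g) = \<langle>\<pi>\<^sub>0 C A, f\<rangle> \<cdot> L C B g"
proof -
  have "B \<in> Obj X"
    using assms Cod_Obj by blast
  moreover have "\<langle>\<pi>\<^sub>0 C B, \<^bold>0 (C \<^bold>\<times> B) A\<rangle> \<cdot> f = \<^bold>0 (C \<^bold>\<times> B) B"
    using assms \<open>B \<in> Obj X\<close> L_zero_at[of "\<pi>\<^sub>0 C B" f C A "C \<^bold>\<times> B"] by (simp add: additive_simps)
  ultimately show ?thesis
    using assms L5[of C A B f g "Cod X g"] by (simp add: Hom_def additive_simps)
qed

lemma differentiation_eq:
  assumes "f \<in> Arr X" "Dom X f = A"
  shows "differentiation X L f = L A A ((\<pi>\<^sub>0 A A \<^bold>+ \<pi>\<^sub>1 A A) \<cdot> f)"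
  using assms by (simp add: differentiation_def oplus_map_def)

lemma differentiation_arr:
  assumes "f \<in> Arr X"
  shows "differentiation X L f \<in> Arr X \<and>
    Dom X (differentiation X L f) = Dom X f \<^bold>\<times> Dom X f \<and> Cod X (differentiation X L f) = Cod X f"
  using assms by (simp add: differentiation_eq additive_simps L_arr)

text \<open>
  The form in which L8 enters below: the context of the translated map is pulled back along \<open>h\<close>.
\<close>

lemma differentiation_substitute:
  assumes "f \<in> Arr X" "Dom X f = A" "h \<in> Arr X" "Cod X h = A" "Dom X h = T"
  shows "L T A ((\<pi>\<^sub>0 T A \<cdot> h \<^bold>+ \<pi>\<^sub>1 T A) \<cdot> f) = \<langle>\<pi>\<^sub>0 T A \<cdot> h, \<pi>\<^sub>1 T A\<rangle> \<cdot> differentiation X L f"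
  using assms Dom_Obj[of f] Dom_Obj[of h]
    L_substitute_context[of h T A "(\<pi>\<^sub>0 A A \<^bold>+ \<pi>\<^sub>1 A A) \<cdot> f" A]
  by (simp add: differentiation_eq additive_simps)

text \<open>
  The map \<open>f\<close> arises from \<open>(c, u) \<mapsto> f((c, 0) + u)\<close> by substituting the linear map
  \<open>u = (0, a)\<close>. Linearization commutes with this substitution, and the linearization of the
  translated map is \<open>D[f]((c, 0), u)\<close>.
\<close>

lemma linearization_differentiation_arr:
  assumes "C \<in> Obj X" "A \<in> Obj X" "f \<in> Arr X" "Dom X f = C \<^bold>\<times> A"
  shows "\<l> C A C A \<cdot> differentiation X L f = L C A f"
proof -
  let ?i = "\<langle>\<^bold>1 C, \<^bold>0 C A\<rangle>" and ?k = "\<langle>\<^bold>0 (C \<^bold>\<times> A) C, \<pi>\<^sub>1 C A\<rangle>"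
  have "L C A f = L C A (\<langle>\<pi>\<^sub>0 C A, ?k\<rangle> \<cdot>
      ((\<pi>\<^sub>0 C (C \<^bold>\<times> A) \<cdot> ?i \<^bold>+ \<pi>\<^sub>1 C (C \<^bold>\<times> A)) \<cdot> f))"
    using assms by (simp add: additive_simps)
  also have "\<dots> = \<langle>\<pi>\<^sub>0 C A, ?k\<rangle> \<cdot> L C (C \<^bold>\<times> A) ((\<pi>\<^sub>0 C (C \<^bold>\<times> A) \<cdot> ?i \<^bold>+ \<pi>\<^sub>1 C (C \<^bold>\<times> A)) \<cdot> f)"
    by (rule L_linear_substitution)
      (use assms in \<open>simp_all add: additive_simps L_Pair_arr L1_Zero L3_Proj1\<close>)
  also have "\<dots> = \<langle>\<pi>\<^sub>0 C A, ?k\<rangle> \<cdot>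
      (\<langle>\<pi>\<^sub>0 C (C \<^bold>\<times> A) \<cdot> ?i, \<pi>\<^sub>1 C (C \<^bold>\<times> A)\<rangle> \<cdot> differentiation X L f)"
    by (subst differentiation_substitute) (use assms in \<open>simp_all add: additive_simps\<close>)
  finally show ?thesis
    using assms by (simp add: additive_simps structure_defs differentiation_arr)
qed

lemma linearization_differentiation: "linearization X (differentiation X L) = L"
proof (intro ext)
  fix C A f
  show "linearization X (differentiation X L) C A f = L C A f"
  proof (cases "C \<in> Obj X \<and> A \<in> Obj X")
    case True
    then have "L C A \<in> extensional {f \<in> Arr X. Dom X f = C \<^bold>\<times> A}"
      using L_type by (auto simp: PiE_def Pi_def)
    then show ?thesis
      using True linearization_differentiation_arr[of C A f]
      by (auto simp: linearization_def extensional_def)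
  next
    case False
    then show ?thesis
      using L_type by (auto simp: linearization_def PiE_def Pi_def extensional_def)
  qed
qed

lemma L_differentiation:
  assumes "f \<in> Arr X" "Dom X f = A"
  shows "L A A (differentiation X L f) = differentiation X L f"
  using assms Dom_Obj[of f] L6[of A A "(\<pi>\<^sub>0 A A \<^bold>+ \<pi>\<^sub>1 A A) \<cdot> f" "Cod X f"]
  by (simp add: differentiation_eq additive_simps Hom_def)

text \<open>
  In the context \<open>x\<close>, the translated map \<open>g(f(x + z))\<close> is the composite of \<open>f(x + z)\<close> with \<open>g\<close>,
  regarded as a map that ignores the context. L5 then moves the base point of \<open>g\<close> to \<open>f(x + 0)\<close>.
\<close>

lemma differentiation_Comp:
  assumes "f \<in> Arr X" "g \<in> Arr X" "Dom X f = A" "Cod X f = Dom X g"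
  shows "differentiation X L (f \<cdot> g) =
    \<langle>\<pi>\<^sub>0 A A \<cdot> f, differentiation X L f\<rangle> \<cdot> differentiation X L g"
proof -
  let ?B = "Dom X g"
  have obj [simp]: "A \<in> Obj X" "?B \<in> Obj X"
    using assms Dom_Obj by auto
  have "differentiation X L (f \<cdot> g) = L A A (\<langle>\<pi>\<^sub>0 A A, (\<pi>\<^sub>0 A A \<^bold>+ \<pi>\<^sub>1 A A) \<cdot> f\<rangle> \<cdot> (\<pi>\<^sub>1 A ?B \<cdot> g))"
    using assms by (simp add: differentiation_eq additive_simps)
  also have "\<dots> = \<langle>\<pi>\<^sub>0 A A, differentiation X L f\<rangle> \<cdot> L A ?B ((\<pi>\<^sub>0 A ?B \<cdot> f \<^bold>+ \<pi>\<^sub>1 A ?B) \<cdot> g)"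
    using assms L5[of A A ?B "(\<pi>\<^sub>0 A A \<^bold>+ \<pi>\<^sub>1 A A) \<cdot> f" "\<pi>\<^sub>1 A ?B \<cdot> g" "Cod X g"]
    by (simp add: differentiation_eq additive_simps Hom_def Add_commute_arr)
  also have "\<dots> = \<langle>\<pi>\<^sub>0 A A \<cdot> f, differentiation X L f\<rangle> \<cdot> differentiation X L g"
    using assms by (simp add: differentiation_substitute additive_simps differentiation_arr)
  finally show ?thesis .
qed

text \<open>
  With arguments \<open>((x, y), z)\<close>: the linearization in \<open>z\<close> of \<open>D[f](x + z, y)\<close>, that is, the second
  derivative of \<open>f\<close> at \<open>x\<close> in the directions \<open>y\<close> and \<open>z\<close>.
\<close>

definition partial_second :: "'o \<Rightarrow> 'm \<Rightarrow> 'm" where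
  "partial_second A f =
     L (A \<^bold>\<times> A) A (\<langle>\<pi>\<^sub>0 (A \<^bold>\<times> A) A \<cdot> \<pi>\<^sub>0 A A \<^bold>+ \<pi>\<^sub>1 (A \<^bold>\<times> A) A, \<pi>\<^sub>0 (A \<^bold>\<times> A) A \<cdot> \<pi>\<^sub>1 A A\<rangle>
       \<cdot> differentiation X L f)"

lemma partial_second_arr:
  assumes "f \<in> Arr X" "Dom X f = A"
  shows "partial_second A f \<in> Arr X \<and> Dom X (partial_second A f) = (A \<^bold>\<times> A) \<^bold>\<times> A \<and>
    Cod X (partial_second A f) = Cod X f"
  using assms Dom_Obj[of f]
  by (simp add: partial_second_def additive_simps L_arr differentiation_arr)

text \<open>
  L7 for the map \<open>(x, (a, b)) \<mapsto> f(x + (a + b))\<close>. Linearizing it in \<open>b\<close> translates the base point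
  of \<open>f\<close> by \<open>a\<close>, which gives \<open>D[f](x + a, b)\<close>; linearizing that in \<open>a\<close> gives the second
  derivative in the directions \<open>b\<close> and \<open>a\<close>. The other order exchanges \<open>a\<close> and \<open>b\<close>.
\<close>

lemma partial_second_symmetric:
  assumes "f \<in> Arr X" "Dom X f = A" "x \<in> Arr X" "y \<in> Arr X" "z \<in> Arr X"
    "Dom X x = Dom X z" "Dom X y = Dom X z" "Cod X x = A" "Cod X y = A" "Cod X z = A"
  shows "\<langle>\<langle>x, y\<rangle>, z\<rangle> \<cdot> partial_second A f = \<langle>\<langle>x, z\<rangle>, y\<rangle> \<cdot> partial_second A f"
proof -
  have [simp]: "A \<in> Obj X"
    using assms Dom_Obj by auto
  let ?p = "\<pi>\<^sub>0 A (A \<^bold>\<times> A)" and ?q = "\<pi>\<^sub>1 A (A \<^bold>\<times> A)" and ?s = "\<pi>\<^sub>0 A A \<^bold>+ \<pi>\<^sub>1 A A"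
  let ?F = "(?p \<^bold>+ (?q \<cdot> \<pi>\<^sub>0 A A \<^bold>+ ?q \<cdot> \<pi>\<^sub>1 A A)) \<cdot> f"
  note simps = additive_simps structure_defs differentiation_arr partial_second_arr
  have assoc: "\<pi>\<^sub>0 (A \<^bold>\<times> A) A \<cdot> \<pi>\<^sub>0 A A \<^bold>+ (\<pi>\<^sub>0 (A \<^bold>\<times> A) A \<cdot> \<pi>\<^sub>1 A A \<^bold>+ \<pi>\<^sub>1 (A \<^bold>\<times> A) A)
      = \<pi>\<^sub>0 (A \<^bold>\<times> A) A \<cdot> ?s \<^bold>+ \<pi>\<^sub>1 (A \<^bold>\<times> A) A"
    "\<pi>\<^sub>0 (A \<^bold>\<times> A) A \<cdot> \<pi>\<^sub>0 A A \<^bold>+ (\<pi>\<^sub>1 (A \<^bold>\<times> A) A \<^bold>+ \<pi>\<^sub>0 (A \<^bold>\<times> A) A \<cdot> \<pi>\<^sub>1 A A)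
      = \<pi>\<^sub>0 (A \<^bold>\<times> A) A \<cdot> ?s \<^bold>+ \<pi>\<^sub>1 (A \<^bold>\<times> A) A"
    by (simp_all add: additive_simps Add_assoc_arr
        Add_commute_arr[of "\<pi>\<^sub>1 (A \<^bold>\<times> A) A" "\<pi>\<^sub>0 (A \<^bold>\<times> A) A \<cdot> \<pi>\<^sub>1 A A"])
  have one: "lin1 X L A A A ?F = \<langle>?p \<^bold>+ ?q \<cdot> \<pi>\<^sub>0 A A, ?q \<cdot> \<pi>\<^sub>1 A A\<rangle> \<cdot> differentiation X L f"
  proof -
    have "alpha_inv X A A A \<cdot> ?F = (\<pi>\<^sub>0 (A \<^bold>\<times> A) A \<cdot> ?s \<^bold>+ \<pi>\<^sub>1 (A \<^bold>\<times> A) A) \<cdot> f"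
      using assms by (subst assoc(1)[symmetric]) (simp add: simps)
    then show ?thesis
      using assms by (simp add: lin1_def differentiation_substitute simps del: Comp_Add_arr)
        (simp add: simps)
  qed
  have zero: "lin0 X L A A A ?F = \<langle>?p \<^bold>+ ?q \<cdot> \<pi>\<^sub>1 A A, ?q \<cdot> \<pi>\<^sub>0 A A\<rangle> \<cdot> differentiation X L f"
  proof -
    have "beta_inv X A A A \<cdot> ?F = (\<pi>\<^sub>0 (A \<^bold>\<times> A) A \<cdot> ?s \<^bold>+ \<pi>\<^sub>1 (A \<^bold>\<times> A) A) \<cdot> f"
      using assms by (subst assoc(2)[symmetric]) (simp add: simps)
    then show ?thesis
      using assms by (simp add: lin0_def differentiation_substitute simps del: Comp_Add_arr)
        (simp add: simps)
  qed
  have "lin0 X L A A A (lin1 X L A A A ?F) = beta_map X A A A \<cdot> partial_second A f"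
    using assms unfolding one by (simp add: lin0_def partial_second_def simps)
  moreover have "lin1 X L A A A (lin0 X L A A A ?F) = alpha_map X A A A \<cdot> partial_second A f"
    using assms unfolding zero by (simp add: lin1_def partial_second_def simps)
  ultimately have "alpha_map X A A A \<cdot> partial_second A f = beta_map X A A A \<cdot> partial_second A f"
    using L7[of A A A ?F "Cod X f"] assms by (simp add: Hom_def additive_simps)
  from arg_cong[OF this, of "\<lambda>k. \<langle>x, \<langle>z, y\<rangle>\<rangle> \<cdot> k"] show ?thesis
    using assms by (simp add: simps)
qed

text \<open>
  Additivity in the direction \<open>(z, w) = (z, 0) + (0, w)\<close> leaves two partial derivatives of
  \<open>D[f](x, y)\<close>. The one in \<open>x\<close> is \<open>partial_second\<close> by definition. The one in \<open>y\<close> linearizes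
  \<open>D[f](x, y + w) = D[f](x, y) + D[f](x, w)\<close> in \<open>w\<close>: the first summand depends on the context only
  and contributes \<open>0\<close>, and the second is linear already.
\<close>

lemma second_derivative_at:
  assumes "f \<in> Arr X" "Dom X f = A" "x \<in> Arr X" "y \<in> Arr X" "z \<in> Arr X" "w \<in> Arr X"
    "Dom X x = Dom X w" "Dom X y = Dom X w" "Dom X z = Dom X w"
    "Cod X x = A" "Cod X y = A" "Cod X z = A" "Cod X w = A"
  shows "\<langle>\<langle>x, y\<rangle>, \<langle>z, w\<rangle>\<rangle> \<cdot> differentiation X L (differentiation X L f)
    = \<langle>\<langle>x, y\<rangle>, z\<rangle> \<cdot> partial_second A f \<^bold>+ \<langle>x, w\<rangle> \<cdot> differentiation X L f"
proof -
  have [simp]: "A \<in> Obj X"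
    using assms Dom_Obj by auto
  let ?D = "differentiation X L f" and ?C = "A \<^bold>\<times> A"
  let ?DD = "differentiation X L ?D" and ?T = "Dom X w"
  let ?G = "(\<pi>\<^sub>0 ?C ?C \<^bold>+ \<pi>\<^sub>1 ?C ?C) \<cdot> ?D"
  note simps = additive_simps differentiation_arr partial_second_arr L_arr
  have DD: "?DD = L ?C ?C ?G"
    using assms by (simp add: differentiation_eq[of ?D] simps)
  let ?i = "\<langle>\<pi>\<^sub>1 ?C A, \<^bold>0 (?C \<^bold>\<times> A) A\<rangle>" and ?j = "\<langle>\<^bold>0 (?C \<^bold>\<times> A) A, \<pi>\<^sub>1 ?C A\<rangle>"
  have "\<langle>\<pi>\<^sub>0 ?C A, ?i\<rangle> \<cdot> ?DD = L ?C A (\<langle>\<pi>\<^sub>0 ?C A, ?i\<rangle> \<cdot> ?G)"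
    unfolding DD
    by (rule L_linear_substitution[symmetric])
      (use assms in \<open>simp_all add: simps L_Pair_arr L1_Zero L3_Proj1\<close>)
  also have "\<langle>\<pi>\<^sub>0 ?C A, ?i\<rangle> \<cdot> ?G = \<langle>\<pi>\<^sub>0 ?C A \<cdot> \<pi>\<^sub>0 A A \<^bold>+ \<pi>\<^sub>1 ?C A, \<pi>\<^sub>0 ?C A \<cdot> \<pi>\<^sub>1 A A\<rangle> \<cdot> ?D"
    using assms Pair_eta_arr(2)[of A A "\<pi>\<^sub>0 ?C A", symmetric]
      Pair_Add_arr[of "\<pi>\<^sub>0 ?C A \<cdot> \<pi>\<^sub>0 A A" "\<pi>\<^sub>0 ?C A \<cdot> \<pi>\<^sub>1 A A" "\<pi>\<^sub>1 ?C A" "\<^bold>0 (?C \<^bold>\<times> A) A"]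
    by (simp add: simps)
  finally have first: "\<langle>\<pi>\<^sub>0 ?C A, ?i\<rangle> \<cdot> ?DD = partial_second A f"
    by (simp add: partial_second_def)
  have "\<langle>\<pi>\<^sub>0 ?C A, ?j\<rangle> \<cdot> ?DD = L ?C A (\<langle>\<pi>\<^sub>0 ?C A, ?j\<rangle> \<cdot> ?G)"
    unfolding DD
    by (rule L_linear_substitution[symmetric])
      (use assms in \<open>simp_all add: simps L_Pair_arr L1_Zero L3_Proj1\<close>)
  also have "\<langle>\<pi>\<^sub>0 ?C A, ?j\<rangle> \<cdot> ?G = \<langle>\<pi>\<^sub>0 ?C A \<cdot> \<pi>\<^sub>0 A A, \<pi>\<^sub>0 ?C A \<cdot> \<pi>\<^sub>1 A A \<^bold>+ \<pi>\<^sub>1 ?C A\<rangle> \<cdot> ?D"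
    using assms Pair_eta_arr(2)[of A A "\<pi>\<^sub>0 ?C A", symmetric]
      Pair_Add_arr[of "\<pi>\<^sub>0 ?C A \<cdot> \<pi>\<^sub>0 A A" "\<pi>\<^sub>0 ?C A \<cdot> \<pi>\<^sub>1 A A" "\<^bold>0 (?C \<^bold>\<times> A) A" "\<pi>\<^sub>1 ?C A"]
    by (simp add: simps)
  also have "\<dots> = \<pi>\<^sub>0 ?C A \<cdot> ?D \<^bold>+ \<langle>\<pi>\<^sub>0 ?C A \<cdot> \<pi>\<^sub>0 A A, \<pi>\<^sub>1 ?C A\<rangle> \<cdot> ?D"
    using assms by (simp add: differentiation_eq[OF assms(1,2)] L_add_at simps)
  also have "L ?C A \<dots> = \<langle>\<pi>\<^sub>0 ?C A \<cdot> \<pi>\<^sub>0 A A, \<pi>\<^sub>1 ?C A\<rangle> \<cdot> L A A ?D"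
    using assms by (simp add: L_Add_arr L_context_only L_substitute_context simps)
  also have "L A A ?D = ?D"
    using assms by (simp add: L_differentiation)
  finally have second: "\<langle>\<pi>\<^sub>0 ?C A, ?j\<rangle> \<cdot> ?DD = \<langle>\<pi>\<^sub>0 ?C A \<cdot> \<pi>\<^sub>0 A A, \<pi>\<^sub>1 ?C A\<rangle> \<cdot> ?D" .
  have "\<langle>\<langle>x, y\<rangle>, \<langle>z, w\<rangle>\<rangle> \<cdot> ?DD = \<langle>\<langle>x, y\<rangle>, \<langle>z, \<^bold>0 ?T A\<rangle> \<^bold>+ \<langle>\<^bold>0 ?T A, w\<rangle>\<rangle> \<cdot> ?DD"
    using assms by (simp add: simps)
  also have "\<dots> = \<langle>\<langle>x, y\<rangle>, \<langle>z, \<^bold>0 ?T A\<rangle>\<rangle> \<cdot> ?DD \<^bold>+ \<langle>\<langle>x, y\<rangle>, \<langle>\<^bold>0 ?T A, w\<rangle>\<rangle> \<cdot> ?DD"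
    unfolding DD by (rule L_add_at) (use assms in \<open>simp_all add: simps\<close>)
  also have "\<langle>\<langle>x, y\<rangle>, \<langle>z, \<^bold>0 ?T A\<rangle>\<rangle> \<cdot> ?DD = \<langle>\<langle>x, y\<rangle>, z\<rangle> \<cdot> partial_second A f"
    unfolding first[symmetric] using assms by (simp add: simps)
  also have "\<langle>\<langle>x, y\<rangle>, \<langle>\<^bold>0 ?T A, w\<rangle>\<rangle> \<cdot> ?DD = \<langle>x, w\<rangle> \<cdot> ?D"
    using arg_cong[OF second, of "\<lambda>k. \<langle>\<langle>x, y\<rangle>, w\<rangle> \<cdot> k"] assms by (simp add: simps)
  finally show ?thesis .
qed

lemma second_derivative_symmetric:
  assumes "f \<in> Arr X" "Dom X f = A"
  shows "\<c> A A A A \<cdot> differentiation X L (differentiation X L f)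
    = differentiation X L (differentiation X L f)"
proof -
  have [simp]: "A \<in> Obj X"
    using assms Dom_Obj by auto
  let ?C = "A \<^bold>\<times> A" and ?DD = "differentiation X L (differentiation X L f)"
  let ?x = "\<pi>\<^sub>0 ?C ?C \<cdot> \<pi>\<^sub>0 A A" and ?y = "\<pi>\<^sub>0 ?C ?C \<cdot> \<pi>\<^sub>1 A A"
    and ?z = "\<pi>\<^sub>1 ?C ?C \<cdot> \<pi>\<^sub>0 A A" and ?w = "\<pi>\<^sub>1 ?C ?C \<cdot> \<pi>\<^sub>1 A A"
  have "\<c> A A A A \<cdot> ?DD = \<langle>\<langle>?x, ?z\<rangle>, \<langle>?y, ?w\<rangle>\<rangle> \<cdot> ?DD"
    by (simp add: additive_simps structure_defs)
  also have "\<dots> = \<langle>\<langle>?x, ?y\<rangle>, \<langle>?z, ?w\<rangle>\<rangle> \<cdot> ?DD"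
    using assms second_derivative_at[OF assms, of ?x ?z ?y ?w]
      second_derivative_at[OF assms, of ?x ?y ?z ?w] partial_second_symmetric[OF assms, of ?x ?y ?z]
    by (simp add: additive_simps del: Pair_eta_arr)
  also have "\<dots> = ?DD"
    using assms by (simp add: additive_simps differentiation_arr)
  finally show ?thesis .
qed

lemma differentiation_differential: "differential_combinator X (differentiation X L)"
proof (unfold_locales, goal_cases)
  case 1
  show ?case
    using differentiation_arr by (auto simp: differentiation_def Hom_def)
next
  case (4 f A B)
  then show ?case
    using Dom_Obj[of f] L2_Add[of A A "(\<pi>\<^sub>0 A A \<^bold>+ \<pi>\<^sub>1 A A) \<cdot> f" B]
    by (simp add: differentiation_eq Hom_def additive_simps)
next
  case (5 f A B)
  then show ?case
    using Dom_Obj[of f] by (auto simp: differentiation_eq Hom_def additive_simps L_zero_at)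
next
  case (6 A)
  then show ?case
    using L_context_only[of "\<^bold>1 A" A A]
    by (simp add: differentiation_eq additive_simps L_Add_arr L3_Proj1)
next
  case (10 f A B g C)
  then show ?case
    using differentiation_Comp by (simp add: Hom_def)
next
  case (11 f A B)
  then have f: "f \<in> Arr X" "Dom X f = A" and [simp]: "A \<in> Obj X"
    using Dom_Obj[of f] by (auto simp: Hom_def)
  show ?case
    using f by (simp add: linearization_differentiation_arr L_differentiation differentiation_arr)
next
  case (12 f A B)
  then show ?case
    using second_derivative_symmetric by (simp add: Hom_def)
qed (auto simp: differentiation_eq Hom_def additive_simps L_Add_arr L_Pair_arr L1_Zero L3_Proj1
    L3_Proj1_Proj0 L3_Proj1_Proj1 L_context_only Dom_Obj)

end

section \<open>The correspondence\<close>

theorem theorem5p14: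
  shows "(\<forall>X :: ('o, 'm) cla_data. cartesian_left_additive_category X \<longrightarrow>
            bij_betw (linearization X) {D. differential_combinator X D} {L. linearizing_system X L} \<and>
            bij_betw (differentiation X) {L. linearizing_system X L} {D. differential_combinator X D} \<and>
            (\<forall>D. differential_combinator X D \<longrightarrow> differentiation X (linearization X D) = D) \<and>
            (\<forall>L. linearizing_system X L \<longrightarrow> linearization X (differentiation X L) = L)) \<and>
         bij_betw (\<lambda>(X, D). (X, linearization X D))
           {(X :: ('o, 'm) cla_data, D). cartesian_differential_category X D}
           {(X :: ('o, 'm) cla_data, L). cartesian_left_additive_category X \<and> linearizing_system X L}"
proof -
  have lin: "linearizing_system X (linearization X D)" "differentiation X (linearization X D) = D"
    if "cartesian_left_additive_category X" "differential_combinator X D"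
    for X :: "('o, 'm) cla_data" and D
  proof -
    interpret cartesian_differential_category X D
      using that by (rule cartesian_differential_category.intro)
    show "linearizing_system X (linearization X D)" "differentiation X (linearization X D) = D"
      by (rule linearization_linearizing differentiation_linearization)+
  qed
  have diff: "differential_combinator X (differentiation X L)"
    "linearization X (differentiation X L) = L"
    if "cartesian_left_additive_category X" "linearizing_system X L"
    for X :: "('o, 'm) cla_data" and L
  proof -
    interpret cartesian_linearizing_category X L
      using that by (rule cartesian_linearizing_category.intro)
    show "differential_combinator X (differentiation X L)"
      "linearization X (differentiation X L) = L"
      by (rule differentiation_differential linearization_differentiation)+
  qed
  have "bij_betw (linearization X) {D. differential_combinator X D} {L. linearizing_system X L}"
    "bij_betw (differentiation X) {L. linearizing_system X L} {D. differential_combinator X D}"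
    if "cartesian_left_additive_category X" for X :: "('o, 'm) cla_data"
    using lin[OF that] diff[OF that]
    by (auto intro: bij_betw_byWitness[of _ "differentiation X"] bij_betw_byWitness[of _ "linearization X"])
  moreover have "bij_betw (\<lambda>(X, D). (X, linearization X D))
      {(X :: ('o, 'm) cla_data, D). cartesian_differential_category X D}
      {(X, L). cartesian_left_additive_category X \<and> linearizing_system X L}"
    by (rule bij_betw_byWitness[of _ "\<lambda>(X, L). (X, differentiation X L)"])
      (auto simp: cartesian_differential_category_def lin diff)
  ultimately show ?thesis
    using lin(2) diff(2) by blast
qed

end
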